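(* Let $n\ge1$ and let $p,q$ satisfy $$0<\frac{n-1}{n}\,p<q\le p<\infty.$$ If $0<t<q$, then there is a constant $C>0$ independent of $f$ such that $$\|\mathcal M_tf\|_{\mathcal M^p_q(\mathbb R^n)}\le C\,\|f\|_{\mathcal M^p_q(\mathbb R^n)}$$ for all $f\in\mathcal M^p_q(\mathbb R^n)$.
   Context: For $0<q\le p<\infty$ the (classical) Morrey norm of a measurable function $f$ on $\mathbb R^n$ is $$\|f\|_{\mathcal M^p_q(\mathbb R^n)}=\sup_Q|Q|^{\frac1p-\frac1q}\left(\int_Q|f(x)|^q\,dx\right)^{1/q},$$ the supremum being over all cubes $Q\subset\mathbb R^n$ with sides parallel to the coordinate axes; $\mathcal M^p_q(\mathbb R^n)$ is the set of measurable $f$ for which it is finite. For $1\le k\le n$ the one-dimensional maximal operator in the $k$-th variable is $M_kf(x)=\sup_{I\ni x_k}\frac1{|I|}\int_I|f(x_1,\ldots,y_k,\ldots,x_n)|\,dy_k$ (supremum over intervals $I\subset\mathbb R$ containing $x_k$). For $t>0$ the iterated maximal operator is $\mathcal M_tf(x)=\left(M_n\cdots M_1[|f|^t](x)\right)^{1/t}$. *)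

theory Defs
  imports "HOL-Analysis.Analysis"
begin

text \<open>
  Morrey norms and maximal operators depend on \<open>f\<close> only through \<open>\<bar>f\<bar>\<close>, and maximal functions may be
  infinite. So they are defined for \<open>F :: real ^ 'n \<Rightarrow> ennreal\<close>, and a complex-valued \<open>f\<close> enters as
  \<open>\<lambda>x. ennreal (norm (f x))\<close>.
\<close>

text \<open>The power \<open>x\<^sup>r\<close> of an extended nonnegative real; only meant for exponents \<open>r > 0\<close>.\<close>

definition ennpowr :: "ennreal \<Rightarrow> real \<Rightarrow> ennreal" where
  "ennpowr x r = (if x = \<infinity> then \<infinity> else ennreal (enn2real x powr r))"

definition cubes :: "(real ^ 'n) set set" where
  "cubes = {cbox a b |a b. \<exists>l>0. \<forall>i. b $ i = a $ i + l}"

definition morrey_norm :: "real \<Rightarrow> real \<Rightarrow> (real ^ 'n \<Rightarrow> ennreal) \<Rightarrow> ennreal" where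
  "morrey_norm p q F =
     (SUP Q\<in>cubes. ennreal (measure lebesgue Q powr (1 / p - 1 / q)) *
        ennpowr (\<integral>\<^sup>+x\<in>Q. ennpowr (F x) q \<partial>lebesgue) (1 / q))"

definition morrey_space :: "real \<Rightarrow> real \<Rightarrow> (real ^ 'n \<Rightarrow> complex) set" where
  "morrey_space p q =
     {f \<in> borel_measurable lebesgue. morrey_norm p q (\<lambda>x. ennreal (norm (f x))) < \<infinity>}"

text \<open>The maximal operator in the \<open>k\<close>-th variable. The intervals are those for which the average
  makes sense, that is, bounded and of positive length; open, closed and half-open ones are allowed.\<close>

definition directional_maximal :: "'n \<Rightarrow> (real ^ 'n \<Rightarrow> ennreal) \<Rightarrow> real ^ 'n \<Rightarrow> ennreal" where
  "directional_maximal k F x =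
     (SUP I\<in>{I :: real set. is_interval I \<and> bounded I \<and> 0 < measure lebesgue I \<and> x $ k \<in> I}.
        (\<integral>\<^sup>+y\<in>I. F (\<chi> j. if j = k then y else x $ j) \<partial>lebesgue) / emeasure lebesgue I)"

text \<open>The coordinates are numbered \<open>1, \<dots>, n\<close> by the linear order on the index type. As \<open>fold\<close> applies
  the operator of the head of the list first, this is \<open>(M\<^sub>n \<cdots> M\<^sub>1 [\<bar>f\<bar>\<^sup>t])\<^bsup>1/t\<^esup>\<close>.\<close>

definition iterated_maximal ::
  "real \<Rightarrow> (real ^ 'n::{finite,linorder} \<Rightarrow> complex) \<Rightarrow> real ^ 'n::{finite,linorder} \<Rightarrow> ennreal" where
  "iterated_maximal t f x =
     ennpowr (fold directional_maximal (sorted_list_of_set UNIV)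
                (\<lambda>y. ennreal (norm (f y) powr t)) x) (1 / t)"

end

theory Submission
  imports Defs
begin

text \<open>
  The operators \<open>M\<^sub>k\<close> are bounded one at a time. Put \<open>s = q/t > 1\<close>, \<open>\<theta> = 1 - q/p\<close> and \<open>G = \<bar>f\<bar>\<^sup>t\<close>. Up to
  taking roots, a bound for the Morrey norm of \<open>f\<close> is an estimate \<open>\<integral>\<^sub>Q G\<^sup>s \<le> L\<bar>Q\<bar>\<^sup>\<theta>\<close> for all cubes \<open>Q\<close>
  (\<open>morrey_norm_le_iff\<close>). It is enough that each \<open>M\<^sub>k\<close> preserves estimates of this type, with \<open>L\<close> replaced by
  a constant multiple, since then they survive the whole iteration.

  Let \<open>Q\<close> have centre \<open>z\<close> and half side \<open>\<rho>\<close>. On a line in direction \<open>k\<close>, parametrized by \<open>y\<close>, the maximal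
  function satisfies a weighted inequality of Fefferman--Stein type,
  \<open>\<integral>\<^sub>J (Mg)\<^sup>s \<le> C \<integral> g\<^sup>s w\<close> with \<open>J = [z\<^sub>k - \<rho>, z\<^sub>k + \<rho>]\<close> and \<open>w(y) = \<rho> / (\<rho> + \<bar>y - z\<^sub>k\<bar>)\<close>; up to constants \<open>w\<close> is the
  maximal function of the indicator of \<open>J\<close>. The inequality follows from the Vitali covering lemma and the
  layer cake formula (\<open>rational_maximal_strong_type\<close>, \<open>interval_weight_dominates\<close>). It treats the part of \<open>g\<close>
  near \<open>Q\<close> and its tail at once. Integration over the other coordinates (\<open>nn_integral_le_by_lines\<close>) and a
  dyadic decomposition of the weight give
  \<open>\<integral>\<^sub>Q (M\<^sub>k G)\<^sup>s \<le> C \<Sum>\<^sub>j 2\<^bsup>-j\<^esup> \<integral> G\<^sup>s \<le> C L \<bar>Q\<bar>\<^sup>\<theta> \<Sum>\<^sub>j 2\<^bsup>j(n\<theta>-1)\<^esup>\<close>, where the \<open>j\<close>-th integral in the middle is over \<open>2\<^sup>jQ\<close>.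
  The series converges exactly when \<open>n\<theta> < 1\<close>, that is, when \<open>(n-1)p/n < q\<close>
  (\<open>rational_directional_maximal_morrey\<close>).

  Measurability is handled by domination. The function \<open>\<bar>f\<bar>\<^sup>t\<close> is replaced by a Borel majorant that agrees with it
  almost everywhere, and the supremum over all intervals by one over balls with rational centre and radius.
  The latter is a countable supremum, so it yields Borel functions again, and it costs only a factor \<open>2\<close>.
\<close>

section \<open>Powers of extended nonnegative reals\<close>

lemma ennpowr_ennreal: "0 \<le> a \<Longrightarrow> ennpowr (ennreal a) s = ennreal (a powr s)"
  by (simp add: ennpowr_def)

lemma ennpowr_extreme_values [simp]: "ennpowr \<infinity> s = \<infinity>" "ennpowr top s = top" "ennpowr 0 s = 0"
  by (simp_all add: ennpowr_def)

lemma ennpowr_mono: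
  assumes "x \<le> y" "0 \<le> s"
  shows "ennpowr x s \<le> ennpowr y s"
proof (cases y)
  case (real b)
  then obtain a where "x = ennreal a" "0 \<le> a"
    using assms(1) by (cases x) (auto simp: top_unique)
  with real assms show ?thesis
    by (simp add: ennpowr_ennreal ennreal_leI powr_mono2)
qed (use assms in simp)

lemma ennpowr_cmult:
  assumes "0 < c"
  shows "ennpowr (ennreal c * x) s = ennreal (c powr s) * ennpowr x s"
proof (cases x)
  case (real a)
  with assms show ?thesis
    by (simp add: ennpowr_ennreal ennreal_mult[symmetric] powr_mult)
next
  case top
  with assms show ?thesis
    by (simp add: ennreal_mult_top)
qed

lemma ennpowr_ennpowr: "ennpowr (ennpowr x a) b = ennpowr x (a * b)"
  by (cases x) (auto simp: ennpowr_ennreal powr_powr)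

lemma ennpowr_diff_one_mult:
  assumes "1 < s"
  shows "x * ennpowr x (s - 1) = ennpowr x s"
proof (cases x)
  case (real a)
  then show ?thesis
    by (cases "a = 0")
       (auto simp: ennpowr_ennreal ennreal_mult[symmetric] powr_diff)
qed (auto simp: ennreal_mult_top)

lemma measurable_ennpowr [measurable (raw)]:
  assumes [measurable]: "F \<in> borel_measurable M"
  shows "(\<lambda>x. ennpowr (F x) s) \<in> borel_measurable M"
  unfolding ennpowr_def by measurable

text \<open>
  The integrand may be singular at \<open>0\<close> (this happens for \<open>s < 1\<close>), so for finite \<open>x\<close> the fundamental
  theorem of calculus is used on the open interval. For \<open>x = \<infinity>\<close> the integral exceeds every \<open>b\<close>,
  because it dominates the integral over \<open>(0, b\<^bsup>1/s\<^esup>)\<close>.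
\<close>
lemma ennpowr_layer_cake:
  assumes s: "0 < s"
  shows "(\<integral>\<^sup>+l. ennreal (s * l powr (s - 1)) * indicator {l. 0 < l \<and> ennreal l < x} l \<partial>lborel)
           = ennpowr x s"
proof -
  have fin: "(\<integral>\<^sup>+l. ennreal (s * l powr (s - 1)) * indicator {0<..<b} l \<partial>lborel) = ennreal (b powr s)"
    if b: "0 < b" for b :: real
  proof -
    have deriv: "((\<lambda>l. l powr s) has_real_derivative s * l powr (s - 1)) (at l)" if "0 < l" for l
      using that by (auto intro!: derivative_eq_intros)
    have lim0: "(((\<lambda>l. l powr s) \<circ> real_of_ereal) \<longlongrightarrow> 0) (at_right (ereal 0))"
      unfolding ereal_tendsto_simps
      using s by (auto intro!: tendsto_eq_intros tendsto_powr' eventually_at_rightI[of 0 1])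
    have limb: "(((\<lambda>l. l powr s) \<circ> real_of_ereal) \<longlongrightarrow> b powr s) (at_left (ereal b))"
      unfolding ereal_tendsto_simps
      using b by (auto intro!: tendsto_intros)
    have cont: "isCont (\<lambda>l. s * l powr (s - 1)) l" if "0 < l" for l
      using that by (auto intro!: continuous_intros)
    have int: "set_integrable lborel (einterval 0 b) (\<lambda>l. s * l powr (s - 1))"
      and eq: "(LBINT l=ereal 0..ereal b. s * l powr (s - 1)) = b powr s - 0"
      using interval_integral_FTC_nonneg[OF _ deriv cont _ lim0 limb] b s
      by (auto simp: zero_ereal_def[symmetric])
    have "(\<integral>\<^sup>+l. ennreal (s * l powr (s - 1)) * indicator {0<..<b} l \<partial>lborel)
        = (\<integral>\<^sup>+l. ennreal (indicator {0<..<b} l * (s * l powr (s - 1))) \<partial>lborel)"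
      by (intro nn_integral_cong) (auto simp: indicator_def)
    also have "\<dots> = ennreal (LBINT l:{0<..<b}. s * l powr (s - 1))"
      unfolding set_lebesgue_integral_def
      using int s by (subst nn_integral_eq_integral)
        (auto simp: set_integrable_def zero_ereal_def indicator_def intro!: AE_I2)
    also have "(LBINT l:{0<..<b}. s * l powr (s - 1)) = b powr s"
      using eq b by (simp add: interval_lebesgue_integral_def)
    finally show ?thesis .
  qed
  show ?thesis
  proof (cases x)
    case (real b)
    have "{l. 0 < l \<and> ennreal l < x} = {0<..<b}"
      using real by (auto simp: ennreal_less_iff)
    with fin[of b] real show ?thesis
      by (cases "b = 0") (auto simp: ennpowr_ennreal)
  next
    case top
    let ?J = "\<integral>\<^sup>+l. ennreal (s * l powr (s - 1)) * indicator {l. 0 < l \<and> ennreal l < x} l \<partial>lborel"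
    have ge: "ennreal b \<le> ?J" if b: "0 < b" for b
    proof -
      have "ennreal b = ennreal ((b powr (1 / s)) powr s)"
        using b s by (simp add: powr_powr)
      also have "\<dots> = (\<integral>\<^sup>+l. ennreal (s * l powr (s - 1)) * indicator {0<..<b powr (1 / s)} l \<partial>lborel)"
        using b by (intro fin[symmetric]) simp
      also have "\<dots> \<le> ?J"
        using top by (intro nn_integral_mono) (auto simp: indicator_def)
      finally show ?thesis .
    qed
    have "?J = top"
    proof (rule ccontr)
      assume "?J \<noteq> top"
      then obtain b where b: "?J = ennreal b" "0 \<le> b"
        by (cases ?J) auto
      with ge[of "b + 1"] show False
        by (simp add: ennreal_le_iff)
    qed
    with top show ?thesis by simp
  qed
qed

section \<open>A weighted maximal inequality on the line\<close>

text \<open>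
  A Vitali selection gives disjoint balls \<open>J\<close> of the family whose dilates \<open>5J\<close> cover the union. The mass
  of \<open>h\<close> on \<open>J\<close> is at least \<open>l\<bar>J\<bar>\<close>, and \<open>W \<ge> \<bar>I \<inter> 5J\<bar> / \<bar>J\<bar>\<close> holds throughout \<open>J\<close>, so
  \<open>l\<bar>I \<inter> 5J\<bar> \<le> \<integral>\<^sub>J h W\<close>; by disjointness these bounds add up. The last hypothesis says that \<open>W\<close> dominates
  (a dilated form of) the maximal function of the indicator of \<open>I\<close>.
\<close>
lemma Vitali_weak_type_finite:
  fixes h W :: "real \<Rightarrow> ennreal" and K :: "(real \<times> real) set"
  assumes K: "finite K" "\<And>c r. (c, r) \<in> K \<Longrightarrow> 0 < r"
    and heavy: "\<And>c r. (c, r) \<in> K \<Longrightarrow> l * ennreal (2 * r) \<le> (\<integral>\<^sup>+y\<in>ball c r. h y \<partial>lborel)"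
    and [measurable]: "h \<in> borel_measurable borel" "W \<in> borel_measurable borel" "I \<in> sets borel"
    and dom: "\<And>c r y. 0 < r \<Longrightarrow> y \<in> ball c r \<Longrightarrow>
                emeasure lborel (I \<inter> ball c (5 * r)) \<le> ennreal (2 * r) * W y"
  shows "l * emeasure lborel (I \<inter> (\<Union>(c, r)\<in>K. ball c r)) \<le> (\<integral>\<^sup>+y. h y * W y \<partial>lborel)"
proof -
  define B where "B = (\<lambda>i::real \<times> real. ball (fst i) (snd i))"
  have [measurable]: "ball c r \<in> sets borel" for c r :: real by simp
  have [measurable]: "B i \<in> sets borel" for i by (simp add: B_def)
  have bnd: "0 < snd i \<and> snd i \<le> Max (snd ` K)" if "i \<in> K" for i
    using K that by (cases i) (auto intro!: Max_ge image_eqI)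
  obtain C where C: "C \<subseteq> K" "pairwise (\<lambda>i j. disjnt (B i) (B j)) C"
      "(\<Union>i\<in>K. B i) \<subseteq> (\<Union>i\<in>C. ball (fst i) (5 * snd i))"
    unfolding B_def
    by (rule Vitali_covering_lemma_balls[where K = K and a = fst and r = snd, OF subset_refl bnd])
  have finC: "finite C" using C(1) K(1) by (rule finite_subset)
  have disj: "disjoint_family_on B C"
    using C(2) by (auto simp: disjoint_family_on_def pairwise_def disjnt_def)
  have each: "l * emeasure lborel (I \<inter> ball (fst i) (5 * snd i))
                \<le> (\<integral>\<^sup>+y. h y * W y * indicator (B i) y \<partial>lborel)" if "i \<in> C" for i
  proof -
    obtain c r where i: "i = (c, r)" by (cases i)
    with that C(1) K(2) have cr: "(c, r) \<in> K" "0 < r" by auto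
    define m where "m = emeasure lborel (I \<inter> ball c (5 * r))"
    have "ennreal (2 * r) * (l * m) = m * (l * ennreal (2 * r))"
      by (simp add: ac_simps)
    also have "\<dots> \<le> m * (\<integral>\<^sup>+y\<in>ball c r. h y \<partial>lborel)"
      by (intro mult_left_mono heavy cr) simp
    also have "\<dots> = (\<integral>\<^sup>+y. m * (h y * indicator (ball c r) y) \<partial>lborel)"
      by (intro nn_integral_cmult[symmetric]) measurable
    also have "\<dots> \<le> (\<integral>\<^sup>+y. ennreal (2 * r) * (h y * W y * indicator (ball c r) y) \<partial>lborel)"
    proof (intro nn_integral_mono)
      fix y
      show "m * (h y * indicator (ball c r) y) \<le> ennreal (2 * r) * (h y * W y * indicator (ball c r) y)"
      proof (cases "y \<in> ball c r")
        case True
        from mult_right_mono[OF dom[OF cr(2) True], of "h y"] True show ?thesis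
          by (simp add: m_def ac_simps)
      qed simp
    qed
    also have "\<dots> = ennreal (2 * r) * (\<integral>\<^sup>+y. h y * W y * indicator (ball c r) y \<partial>lborel)"
      by (intro nn_integral_cmult) measurable
    finally show ?thesis
      using cr(2) by (simp add: ennreal_mult_le_mult_iff m_def i B_def)
  qed
  have "l * emeasure lborel (I \<inter> (\<Union>i\<in>K. B i))
      \<le> l * emeasure lborel (\<Union>i\<in>C. I \<inter> ball (fst i) (5 * snd i))"
    using C(3) finC by (intro mult_left_mono emeasure_mono) (auto intro!: sets.finite_UN)
  also have "\<dots> \<le> l * (\<Sum>i\<in>C. emeasure lborel (I \<inter> ball (fst i) (5 * snd i)))"
    using finC by (intro mult_left_mono emeasure_subadditive_finite) auto
  also have "\<dots> \<le> (\<Sum>i\<in>C. \<integral>\<^sup>+y. h y * W y * indicator (B i) y \<partial>lborel)"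
    unfolding sum_distrib_left by (intro sum_mono each)
  also have "\<dots> = (\<integral>\<^sup>+y. (\<Sum>i\<in>C. h y * W y * indicator (B i) y) \<partial>lborel)"
    by (intro nn_integral_sum[symmetric]) measurable
  also have "\<dots> = (\<integral>\<^sup>+y. h y * W y * indicator (\<Union>i\<in>C. B i) y \<partial>lborel)"
    by (simp add: indicator_UN_disjoint[OF finC disj] sum_distrib_left)
  also have "\<dots> \<le> (\<integral>\<^sup>+y. h y * W y \<partial>lborel)"
    by (intro nn_integral_mono) (auto simp: indicator_def)
  finally show ?thesis
    by (simp add: B_def case_prod_unfold)
qed

definition rational_balls :: "(real \<times> real) set" where
  "rational_balls = {(c, r). c \<in> \<rat> \<and> r \<in> \<rat> \<and> 0 < r}"

text \<open>
  Dividing by \<open>r\<close>, not by the length \<open>2r\<close>, makes this the supremum of \<^emph>\<open>twice\<close> the averages. The factor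
  \<open>2\<close> absorbs the loss when an arbitrary interval is enlarged to a ball from this countable family.
\<close>
definition rational_maximal :: "(real \<Rightarrow> ennreal) \<Rightarrow> real \<Rightarrow> ennreal" where
  "rational_maximal g x = (SUP (c, r)\<in>rational_balls.
     indicator (ball c r) x * ((\<integral>\<^sup>+y\<in>ball c r. g y \<partial>lborel) / ennreal r))"

lemma countable_rational_balls: "countable rational_balls"
proof (rule countable_subset)
  show "rational_balls \<subseteq> \<rat> \<times> \<rat>" by (auto simp: rational_balls_def)
  show "countable (\<rat> \<times> \<rat> :: (real \<times> real) set)" by (intro countable_SIGMA countable_rat)
qed

lemma measurable_rational_maximal [measurable]:
  assumes [measurable]: "g \<in> borel_measurable borel"
  shows "rational_maximal g \<in> borel_measurable borel"
  unfolding rational_maximal_def[abs_def] case_prod_unfold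
  by (intro borel_measurable_SUP countable_rational_balls borel_measurable_times_ennreal
        borel_measurable_indicator borel_measurable_const) auto

text \<open>
  Where \<open>g \<le> l\<close>, the function contributes at most \<open>2lr\<close> to \<open>\<integral>\<^sub>J g\<close> over a ball \<open>J\<close> of radius \<open>r\<close>. Hence a
  ball with \<open>\<integral>\<^sub>J g \<ge> 4lr\<close> still carries mass \<open>2lr = l\<bar>J\<bar>\<close> of the part of \<open>g\<close> above \<open>l\<close>. So the Vitali bound
  applies to that part alone, which is what makes the integration over \<open>l\<close> below converge. Countably
  many balls are exhausted by finite subfamilies.
\<close>
lemma rational_maximal_weak_type:
  fixes g W :: "real \<Rightarrow> ennreal"
  assumes [measurable]: "g \<in> borel_measurable borel" "W \<in> borel_measurable borel" "I \<in> sets borel"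
    and dom: "\<And>c r y. 0 < r \<Longrightarrow> y \<in> ball c r \<Longrightarrow>
                emeasure lborel (I \<inter> ball c (5 * r)) \<le> ennreal (2 * r) * W y"
    and l: "0 < l"
  shows "ennreal l * emeasure lborel (I \<inter> {x. ennreal (4 * l) < rational_maximal g x})
           \<le> (\<integral>\<^sup>+y. g y * indicator {y. ennreal l < g y} y * W y \<partial>lborel)"
proof -
  define h where "h = (\<lambda>y. g y * indicator {y. ennreal l < g y} y)"
  have [measurable]: "h \<in> borel_measurable borel" unfolding h_def by measurable
  define K where "K = {(c, r)\<in>rational_balls. ennreal l * ennreal (2 * r) \<le> (\<integral>\<^sup>+y\<in>ball c r. h y \<partial>lborel)}"
  have sup: "x \<in> (\<Union>(c, r)\<in>K. ball c r)" if x: "ennreal (4 * l) < rational_maximal g x" for x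
  proof -
    obtain c r where cr: "(c, r) \<in> rational_balls"
      and less: "ennreal (4 * l) < indicator (ball c r) x * ((\<integral>\<^sup>+y\<in>ball c r. g y \<partial>lborel) / ennreal r)"
      using x unfolding rational_maximal_def less_SUP_iff by auto
    have r: "0 < r" using cr by (auto simp: rational_balls_def)
    have xin: "x \<in> ball c r" using less by (cases "x \<in> ball c r") simp_all
    have "ennreal (4 * l) * ennreal r \<le> (\<integral>\<^sup>+y\<in>ball c r. g y \<partial>lborel)"
    proof (rule ccontr)
      assume "\<not> ?thesis"
      then have "(\<integral>\<^sup>+y\<in>ball c r. g y \<partial>lborel) / ennreal r \<le> ennreal (4 * l)"
        using r by (intro divide_le_posI_ennreal) (auto simp: ac_simps)
      with less xin show False by simp
    qed
    also have "\<dots> \<le> (\<integral>\<^sup>+y. h y * indicator (ball c r) y + ennreal l * indicator (ball c r) y \<partial>lborel)"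
      by (intro nn_integral_mono) (auto simp: h_def indicator_def not_less)
    also have "\<dots> = (\<integral>\<^sup>+y\<in>ball c r. h y \<partial>lborel) + ennreal l * ennreal (2 * r)"
      using r by (subst nn_integral_add) (auto simp: nn_integral_cmult ball_eq_greaterThanLessThan)
    also have "ennreal (4 * l) * ennreal r = ennreal l * ennreal (2 * r) + ennreal l * ennreal (2 * r)"
      using l r by (simp add: ennreal_mult[symmetric] ennreal_plus[symmetric] del: ennreal_plus)
    finally have "ennreal l * ennreal (2 * r) + ennreal l * ennreal (2 * r)
        \<le> (\<integral>\<^sup>+y\<in>ball c r. h y \<partial>lborel) + ennreal l * ennreal (2 * r)" .
    then have "ennreal l * ennreal (2 * r) \<le> (\<integral>\<^sup>+y\<in>ball c r. h y \<partial>lborel)"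
      using l r by (simp add: ennreal_mult[symmetric] ennreal_add_left_cancel_le add.commute)
    with cr xin show ?thesis by (auto simp: K_def)
  qed
  show ?thesis
  proof (cases "K = {}")
    case True
    then have "{x. ennreal (4 * l) < rational_maximal g x} = {}" using sup by auto
    then show ?thesis by simp
  next
    case False
    have cK: "countable K"
      by (rule countable_subset[OF _ countable_rational_balls]) (auto simp: K_def)
    define U where "U = (\<lambda>n. \<Union>(c, r)\<in>from_nat_into K ` {..n}. ball c r)"
    have inK: "from_nat_into K ` A \<subseteq> K" for A
      using range_from_nat_into_subset[OF False] by auto
    have UU: "(\<Union>n. U n) = (\<Union>(c, r)\<in>K. ball c r)"
    proof -
      have "(\<Union>n. from_nat_into K ` {..n}) = from_nat_into K ` UNIV"
        by auto
      then have "(\<Union>n. from_nat_into K ` {..n}) = K"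
        using range_from_nat_into[OF False cK] by simp
      moreover have "(\<Union>n. U n) = (\<Union>(c, r)\<in>(\<Union>n. from_nat_into K ` {..n}). ball c r)"
        unfolding U_def by (rule SUP_UNION[symmetric])
      ultimately show ?thesis by simp
    qed
    have [measurable]: "U n \<in> sets borel" for n
      unfolding U_def by (auto simp: case_prod_unfold)
    have step: "ennreal l * emeasure lborel (I \<inter> U n) \<le> (\<integral>\<^sup>+y. h y * W y \<partial>lborel)" for n
      unfolding U_def
    proof (rule Vitali_weak_type_finite)
      fix c r assume "(c, r) \<in> from_nat_into K ` {..n}"
      then have "(c, r) \<in> K" using inK by blast
      then show "0 < r" "ennreal l * ennreal (2 * r) \<le> (\<integral>\<^sup>+y\<in>ball c r. h y \<partial>lborel)"
        by (auto simp: K_def rational_balls_def)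
    qed (auto intro: dom)
    have "ennreal l * emeasure lborel (I \<inter> {x. ennreal (4 * l) < rational_maximal g x})
        \<le> ennreal l * emeasure lborel (\<Union>n. I \<inter> U n)"
    proof (intro mult_left_mono emeasure_mono)
      show "I \<inter> {x. ennreal (4 * l) < rational_maximal g x} \<subseteq> (\<Union>n. I \<inter> U n)"
        using sup unfolding UU[symmetric] by blast
    qed auto
    also have "\<dots> = ennreal l * (SUP n. emeasure lborel (I \<inter> U n))"
    proof -
      have "incseq (\<lambda>n. I \<inter> U n)"
        unfolding incseq_def U_def
        by (intro allI impI Int_mono UN_mono image_mono subset_refl) simp
      then show ?thesis by (subst SUP_emeasure_incseq) auto
    qed
    also have "\<dots> = (SUP n. ennreal l * emeasure lborel (I \<inter> U n))"
      by (rule SUP_mult_left_ennreal)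
    also have "\<dots> \<le> (\<integral>\<^sup>+y. h y * W y \<partial>lborel)"
      by (intro SUP_least step)
    finally show ?thesis by (simp add: h_def)
  qed
qed

text \<open>
  The Fefferman--Stein weighted inequality. By the layer cake formula the left side is an integral over
  \<open>l\<close> of \<open>l\<^bsup>s-1\<^esup>\<close> times the measure of a superlevel set. The weak-type bound and Tonelli's theorem
  turn it into \<open>\<integral> g W \<integral>\<^sub>0\<^sup>g l\<^bsup>s-2\<^esup> dl\<close>, whose inner integral is finite because \<open>s > 1\<close>.
\<close>
lemma rational_maximal_strong_type:
  fixes g W :: "real \<Rightarrow> ennreal"
  assumes [measurable]: "g \<in> borel_measurable borel" "W \<in> borel_measurable borel" "I \<in> sets borel"
    and dom: "\<And>c r y. 0 < r \<Longrightarrow> y \<in> ball c r \<Longrightarrow>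
                emeasure lborel (I \<inter> ball c (5 * r)) \<le> ennreal (2 * r) * W y"
    and s: "1 < s"
  shows "(\<integral>\<^sup>+x\<in>I. ennpowr (rational_maximal g x) s \<partial>lborel)
           \<le> ennreal (4 powr s * s / (s - 1)) * (\<integral>\<^sup>+y. ennpowr (g y) s * W y \<partial>lborel)"
proof -
  let ?T = "rational_maximal g"
  \<comment> \<open>The layer cake formula is applied to a quarter of the maximal function, because the weak-type bound
    at height \<open>l\<close> controls the set where the maximal function exceeds \<open>4l\<close>.\<close>
  have T4: "ennpowr (?T x) s = ennreal (4 powr s) *
      (\<integral>\<^sup>+l. ennreal (s * l powr (s - 1)) * indicator {l. 0 < l \<and> ennreal (4 * l) < ?T x} l \<partial>lborel)" for x
  proof -
    have eq: "?T x = ennreal 4 * (?T x / 4)"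
      by (simp add: ennreal_times_divide mult.commute[of 4] ennreal_mult_divide_eq)
    have iff: "ennreal l < ?T x / 4 \<longleftrightarrow> ennreal (4 * l) < ?T x" if "0 < l" for l
    proof -
      have "ennreal (4 * l) = 4 * ennreal l" using that by (simp add: ennreal_mult)
      moreover have "4 * ennreal l < 4 * (?T x / 4) \<longleftrightarrow> ennreal l < ?T x / 4"
        using ennreal_mult_le_mult_iff[of 4 "?T x / 4" "ennreal l"] by (auto simp: not_le[symmetric])
      ultimately show ?thesis using eq by simp
    qed
    have "ennpowr (?T x) s = ennreal (4 powr s) * ennpowr (?T x / 4) s"
      by (subst eq, subst ennpowr_cmult) auto
    also have "ennpowr (?T x / 4) s =
        (\<integral>\<^sup>+l. ennreal (s * l powr (s - 1)) * indicator {l. 0 < l \<and> ennreal l < ?T x / 4} l \<partial>lborel)"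
      using s by (intro ennpowr_layer_cake[symmetric]) simp
    also have "{l. 0 < l \<and> ennreal l < ?T x / 4} = {l. 0 < l \<and> ennreal (4 * l) < ?T x}"
      using iff by auto
    finally show ?thesis .
  qed
  have weak: "ennreal (s * l powr (s - 1)) * emeasure lborel (I \<inter> {x. ennreal (4 * l) < ?T x})
      \<le> ennreal (s * l powr (s - 2)) * (\<integral>\<^sup>+y. g y * indicator {y. ennreal l < g y} y * W y \<partial>lborel)"
    if l: "0 < l" for l
  proof -
    have "ennreal (s * l powr (s - 1)) = ennreal (s * l powr (s - 2)) * ennreal l"
      using l s powr_mult_base[of l "s - 2"]
      by (simp add: ennreal_mult[symmetric] mult.assoc mult.commute[of _ l])
    then show ?thesis
      using rational_maximal_weak_type[OF assms(1-3) dom l] by (simp add: mult.assoc mult_left_mono)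
  qed
  have "(\<integral>\<^sup>+x\<in>I. ennpowr (?T x) s \<partial>lborel)
      = (\<integral>\<^sup>+x. (\<integral>\<^sup>+l. ennreal (4 powr s) * (ennreal (s * l powr (s - 1)) * indicator {0<..} l
           * indicator (I \<inter> {x. ennreal (4 * l) < ?T x}) x) \<partial>lborel) \<partial>lborel)"
    unfolding T4
    by (intro nn_integral_cong, subst nn_integral_cmult[symmetric], measurable,
        subst nn_integral_multc[symmetric], measurable)
       (auto intro!: nn_integral_cong simp: indicator_def)
  also have "\<dots> = (\<integral>\<^sup>+l. (\<integral>\<^sup>+x. ennreal (4 powr s) * (ennreal (s * l powr (s - 1)) * indicator {0<..} l
           * indicator (I \<inter> {x. ennreal (4 * l) < ?T x}) x) \<partial>lborel) \<partial>lborel)"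
    by (rule lborel_pair.Fubini'[symmetric]) measurable
  also have "\<dots> = (\<integral>\<^sup>+l. ennreal (4 powr s) * (ennreal (s * l powr (s - 1))
           * emeasure lborel (I \<inter> {x. ennreal (4 * l) < ?T x})) * indicator {0<..} l \<partial>lborel)"
    by (intro nn_integral_cong)
       (simp add: nn_integral_cmult mult.assoc[symmetric] nn_integral_cmult_indicator, simp add: ac_simps)
  also have "\<dots> \<le> (\<integral>\<^sup>+l. ennreal (4 powr s) * (ennreal (s * l powr (s - 2)) *
           (\<integral>\<^sup>+y. g y * indicator {y. ennreal l < g y} y * W y \<partial>lborel)) * indicator {0<..} l \<partial>lborel)"
  proof (intro nn_integral_mono)
    fix l :: real
    show "ennreal (4 powr s) * (ennreal (s * l powr (s - 1))
           * emeasure lborel (I \<inter> {x. ennreal (4 * l) < ?T x})) * indicator {0<..} l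
         \<le> ennreal (4 powr s) * (ennreal (s * l powr (s - 2)) *
           (\<integral>\<^sup>+y. g y * indicator {y. ennreal l < g y} y * W y \<partial>lborel)) * indicator {0<..} l"
    proof (cases "0 < l")
      case True
      then have "indicator {0<..} l = (1 :: ennreal)" by simp
      then show ?thesis
        by (simp only: mult_1_right) (intro mult_left_mono weak[OF True] zero_le)
    qed simp
  qed
  also have "\<dots> = (\<integral>\<^sup>+l. (\<integral>\<^sup>+y. ennreal (4 powr s) * (ennreal (s * l powr (s - 2)) *
           (g y * indicator {y. ennreal l < g y} y * W y)) * indicator {0<..} l \<partial>lborel) \<partial>lborel)"
    by (simp add: nn_integral_cmult nn_integral_multc)
  also have "\<dots> = (\<integral>\<^sup>+y. (\<integral>\<^sup>+l. ennreal (4 powr s) * (ennreal (s * l powr (s - 2)) *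
           (g y * indicator {y. ennreal l < g y} y * W y)) * indicator {0<..} l \<partial>lborel) \<partial>lborel)"
    by (rule lborel_pair.Fubini') measurable
  also have "\<dots> = (\<integral>\<^sup>+y. ennreal (4 powr s * s / (s - 1)) * (ennpowr (g y) s * W y) \<partial>lborel)"
  proof (intro nn_integral_cong)
    fix y
    have "(\<integral>\<^sup>+l. ennreal (4 powr s) * (ennreal (s * l powr (s - 2)) *
           (g y * indicator {y. ennreal l < g y} y * W y)) * indicator {0<..} l \<partial>lborel)
      = (\<integral>\<^sup>+l. ennreal (4 powr s * s / (s - 1)) * (g y * W y) * (ennreal ((s - 1) * l powr (s - 1 - 1)) *
           indicator {l. 0 < l \<and> ennreal l < g y} l) \<partial>lborel)"
    proof (intro nn_integral_cong)
      fix l :: real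
      have swap: "a * (b * (g y * indicator {y. ennreal l < g y} y * W y)) * indicator {0<..} l
          = c * (g y * W y) * (d * indicator {l. 0 < l \<and> ennreal l < g y} l)"
        if "a * b = c * d" for a b c d :: ennreal
      proof (cases "0 < l \<and> ennreal l < g y")
        case True
        have "a * (b * (g y * W y)) = (a * b) * (g y * W y)" by (simp only: mult.assoc)
        also have "\<dots> = c * (g y * W y) * d" unfolding that by (simp only: ac_simps)
        finally show ?thesis using True by simp
      qed auto
      have "ennreal (4 powr s) * ennreal (s * l powr (s - 2))
          = ennreal (4 powr s * s / (s - 1)) * ennreal ((s - 1) * l powr (s - 1 - 1))"
        using s by (simp add: ennreal_mult[symmetric])
      then show "ennreal (4 powr s) * (ennreal (s * l powr (s - 2)) *
           (g y * indicator {y. ennreal l < g y} y * W y)) * indicator {0<..} l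
         = ennreal (4 powr s * s / (s - 1)) * (g y * W y) * (ennreal ((s - 1) * l powr (s - 1 - 1)) *
           indicator {l. 0 < l \<and> ennreal l < g y} l)"
        by (rule swap)
    qed
    also have "\<dots> = ennreal (4 powr s * s / (s - 1)) * (g y * W y) * ennpowr (g y) (s - 1)"
      using s ennpowr_layer_cake[of "s - 1" "g y"] by (subst nn_integral_cmult) auto
    also have "\<dots> = ennreal (4 powr s * s / (s - 1)) * (ennpowr (g y) s * W y)"
      unfolding ennpowr_diff_one_mult[OF s, of "g y", symmetric] by (simp only: ac_simps)
    finally show "(\<integral>\<^sup>+l. ennreal (4 powr s) * (ennreal (s * l powr (s - 2)) *
           (g y * indicator {y. ennreal l < g y} y * W y)) * indicator {0<..} l \<partial>lborel)
      = ennreal (4 powr s * s / (s - 1)) * (ennpowr (g y) s * W y)" .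
  qed
  also have "\<dots> = ennreal (4 powr s * s / (s - 1)) * (\<integral>\<^sup>+y. ennpowr (g y) s * W y \<partial>lborel)"
    by (intro nn_integral_cmult) measurable
  finally show ?thesis .
qed

text \<open>
  If \<open>ball c (5 * r)\<close> meets the interval, then \<open>\<rho> + \<bar>y - a\<bar> < 6r + 2\<rho>\<close>, while the intersection has length
  at most \<open>min (2\<rho>) (10r)\<close>. The product of these two is at most \<open>12r\<rho> + 20r\<rho> = 2r \<sqdot> 16\<rho>\<close>.
\<close>
lemma interval_weight_dominates:
  fixes a c r \<rho> y :: real
  assumes "0 < \<rho>" "0 < r" "y \<in> ball c r"
  shows "emeasure lborel (cball a \<rho> \<inter> ball c (5 * r))
           \<le> ennreal (2 * r) * ennreal (16 * \<rho> / (\<rho> + \<bar>y - a\<bar>))"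
proof (cases "cball a \<rho> \<inter> ball c (5 * r) = {}")
  case True
  then show ?thesis by simp
next
  case False
  then have "\<bar>c - a\<bar> < 5 * r + \<rho>" by (auto simp: dist_real_def)
  with assms have d: "\<rho> + \<bar>y - a\<bar> < 6 * r + 2 * \<rho>" by (auto simp: dist_real_def)
  have "emeasure lborel (cball a \<rho> \<inter> ball c (5 * r)) \<le> ennreal (2 * \<rho>)"
    using assms emeasure_mono[of "cball a \<rho> \<inter> ball c (5 * r)" "cball a \<rho>" lborel]
    by (simp add: cball_eq_atLeastAtMost)
  moreover have "emeasure lborel (cball a \<rho> \<inter> ball c (5 * r)) \<le> ennreal (10 * r)"
    using assms emeasure_mono[of "cball a \<rho> \<inter> ball c (5 * r)" "ball c (5 * r)" lborel]
    by (simp add: ball_eq_greaterThanLessThan)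
  ultimately have "emeasure lborel (cball a \<rho> \<inter> ball c (5 * r)) \<le> ennreal (min (2 * \<rho>) (10 * r))"
    by (simp add: min_def)
  also have "\<dots> \<le> ennreal (2 * r * (16 * \<rho> / (\<rho> + \<bar>y - a\<bar>)))"
  proof (rule ennreal_leI)
    have "min (2 * \<rho>) (10 * r) * (\<rho> + \<bar>y - a\<bar>) \<le> min (2 * \<rho>) (10 * r) * (6 * r + 2 * \<rho>)"
      using d assms by (intro mult_left_mono) auto
    also have "\<dots> = min (2 * \<rho>) (10 * r) * (6 * r) + min (2 * \<rho>) (10 * r) * (2 * \<rho>)"
      by (simp add: algebra_simps)
    also have "\<dots> \<le> (2 * \<rho>) * (6 * r) + (10 * r) * (2 * \<rho>)"
      using assms by (intro add_mono mult_right_mono) auto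
    finally show "min (2 * \<rho>) (10 * r) \<le> 2 * r * (16 * \<rho> / (\<rho> + \<bar>y - a\<bar>))"
      using assms by (simp add: field_simps add_pos_nonneg)
  qed
  also have "\<dots> = ennreal (2 * r) * ennreal (16 * \<rho> / (\<rho> + \<bar>y - a\<bar>))"
    using assms by (intro ennreal_mult) auto
  finally show ?thesis .
qed

section \<open>The maximal operator in one coordinate direction\<close>

abbreviation upd :: "real ^ 'n \<Rightarrow> 'n \<Rightarrow> real \<Rightarrow> real ^ 'n" where
  "upd x k y \<equiv> (\<chi> j. if j = k then y else x $ j)"

lemma measurable_vec_nth [measurable]: "(\<lambda>x::real ^ 'n. x $ k) \<in> borel_measurable borel"
  by (intro borel_measurable_continuous_onI continuous_intros)

lemma ennreal_inverse_antimono: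
  fixes a b :: ennreal
  assumes "a \<le> b"
  shows "inverse b \<le> inverse a"
proof (cases "a = 0 \<or> b = top")
  case False
  with assms obtain u v where "a = ennreal u" "b = ennreal v" "0 \<le> u" "0 \<le> v"
    by (cases a; cases b) (auto simp: top_unique)
  with False assms show ?thesis
    by (auto simp: inverse_ennreal less_le intro!: ennreal_leI le_imp_inverse_le)
qed auto

lemma measurable_upd [measurable]:
  fixes k :: "'n::finite"
  shows "(\<lambda>(x, y). upd x k y) \<in> borel_measurable (borel \<Otimes>\<^sub>M (borel :: real measure))"
proof -
  have "continuous_on UNIV (\<lambda>p::(real ^ 'n) \<times> real. (if j = k then snd p else fst p $ j))" for j :: 'n
    by (cases "j = k") (auto intro!: continuous_intros)
  then show ?thesis
    unfolding borel_prod case_prod_unfold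
    by (intro borel_measurable_continuous_onI continuous_on_vec_lambda)
qed

text \<open>
  Tonelli's theorem with the \<open>k\<close>-th coordinate integrated first; Lebesgue measure is the image of the
  product measure indexed by the standard basis.
\<close>
lemma nn_integral_le_by_lines:
  fixes H1 H2 :: "real ^ 'n \<Rightarrow> ennreal"
  assumes [measurable]: "H1 \<in> borel_measurable borel" "H2 \<in> borel_measurable borel"
    and le: "\<And>x. (\<integral>\<^sup>+y. H1 (upd x k y) \<partial>lborel) \<le> (\<integral>\<^sup>+y. H2 (upd x k y) \<partial>lborel)"
  shows "(\<integral>\<^sup>+x. H1 x \<partial>lborel) \<le> (\<integral>\<^sup>+x. H2 x \<partial>lborel)"
proof -
  interpret product_sigma_finite "\<lambda>_. lborel :: real measure" ..
  define e where "e = (axis k 1 :: real ^ 'n)"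
  define B where "B = (Basis :: (real ^ 'n) set) - {e}"
  define J where "J = (\<lambda>f::real ^ 'n \<Rightarrow> real. \<Sum>b\<in>Basis. f b *\<^sub>R b)"
  have B: "finite B" "e \<notin> B" "Basis = insert e B"
    by (auto simp: B_def e_def axis_in_Basis_iff)
  have J: "J \<in> (\<Pi>\<^sub>M b\<in>Basis. lborel) \<rightarrow>\<^sub>M borel"
    unfolding J_def by measurable
  \<comment> \<open>\<open>J\<close> assembles a vector from its coordinates; changing the coordinate of \<open>e\<close> moves it along its line.\<close>
  have Jupd: "J (f(e := y)) = upd (J f) k y" for f y
  proof -
    have "J (f(e := y)) $ j = upd (J f) k y $ j" for j
    proof -
      have "(\<Sum>b\<in>B. (f(e := y)) b * b $ k) = 0"
      proof (intro sum.neutral ballI)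
        fix b assume "b \<in> B"
        then obtain i where "b = axis i 1" "i \<noteq> k"
          by (auto simp: B_def e_def Basis_vec_def)
        then show "(f(e := y)) b * b $ k = 0" by (simp add: axis_def)
      qed
      moreover have "(\<Sum>b\<in>B. (f(e := y)) b * b $ j) = (\<Sum>b\<in>B. f b * b $ j)"
        by (rule sum.cong) (auto simp: B_def)
      ultimately show ?thesis
        using B(1,2) unfolding J_def B(3)
        by (auto simp: e_def axis_def)
    qed
    then show ?thesis by (simp add: vec_eq_iff)
  qed
  have split: "(\<integral>\<^sup>+x. H x \<partial>lborel) = (\<integral>\<^sup>+f. (\<integral>\<^sup>+y. H (upd (J f) k y) \<partial>lborel) \<partial>(\<Pi>\<^sub>M b\<in>B. lborel))"
    if [measurable]: "H \<in> borel_measurable borel" for H :: "real ^ 'n \<Rightarrow> ennreal"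
  proof -
    have "(\<integral>\<^sup>+x. H x \<partial>lborel) = (\<integral>\<^sup>+f. H (J f) \<partial>(\<Pi>\<^sub>M b\<in>Basis. lborel))"
      using J by (subst lborel_eq) (simp add: nn_integral_distr J_def)
    also have "\<dots> = (\<integral>\<^sup>+f. (\<integral>\<^sup>+y. H (J (f(e := y))) \<partial>lborel) \<partial>(\<Pi>\<^sub>M b\<in>B. lborel))"
      unfolding B(3)
      by (intro product_nn_integral_insert B measurable_compose[OF J[unfolded B(3)]]) measurable
    finally show ?thesis by (simp add: Jupd)
  qed
  show ?thesis
    by (simp add: split nn_integral_mono le)
qed

definition rational_directional_maximal :: "'n \<Rightarrow> (real ^ 'n \<Rightarrow> ennreal) \<Rightarrow> real ^ 'n \<Rightarrow> ennreal" where
  "rational_directional_maximal k G x = rational_maximal (\<lambda>y. G (upd x k y)) (x $ k)"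

lemma measurable_rational_directional_maximal [measurable]:
  fixes G :: "real ^ 'n \<Rightarrow> ennreal" and k :: 'n
  assumes [measurable]: "G \<in> borel_measurable borel"
  shows "rational_directional_maximal k G \<in> borel_measurable borel"
proof -
  have [measurable]: "ball c r \<in> sets borel" for c r :: real by simp
  have [measurable]: "(\<lambda>x::real ^ 'n. indicator (ball c r) (x $ k) :: ennreal) \<in> borel_measurable borel" for c r
    by (rule measurable_compose[OF measurable_vec_nth borel_measurable_indicator]) simp
  have [measurable]: "(\<lambda>x. \<integral>\<^sup>+y\<in>ball c r. G (upd x k y) \<partial>lborel) \<in> borel_measurable borel" for c r
  proof (rule lborel.borel_measurable_nn_integral)
    have "(\<lambda>p. G ((\<lambda>(x, y). upd x k y) p) * indicator (ball c r) (snd p))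
            \<in> borel_measurable (borel \<Otimes>\<^sub>M lborel)"
      by measurable
    then show "(\<lambda>(x, y). G (upd x k y) * indicator (ball c r) y)
            \<in> borel_measurable (borel \<Otimes>\<^sub>M lborel)"
      by (simp add: case_prod_unfold)
  qed
  show ?thesis
    unfolding rational_directional_maximal_def[abs_def] rational_maximal_def case_prod_unfold
    by (intro borel_measurable_SUP countable_rational_balls) measurable
qed

text \<open>
  The centre is taken within a quarter of the length from the midpoint, and the radius between three
  quarters of the length and the length, so that the ball covers the closure of \<open>I\<close>.
\<close>
lemma interval_in_rational_ball:
  fixes I :: "real set"
  assumes "is_interval I" "bounded I" "0 < measure lebesgue I"
  obtains c r where "(c, r) \<in> rational_balls" "I \<subseteq> ball c r" "ennreal r \<le> emeasure lebesgue I"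
proof -
  have I: "I \<in> sets lebesgue" "I \<noteq> {}"
    using assms(3) measure_notin_sets[of I lebesgue] by auto
  define a b where "a = Inf I" and "b = Sup I"
  have sub: "I \<subseteq> {a..b}"
    using assms(2) by (auto simp: a_def b_def intro!: cInf_lower cSup_upper bounded_imp_bdd_below bounded_imp_bdd_above)
  have "{a<..<b} \<subseteq> I"
  proof
    fix x assume x: "x \<in> {a<..<b}"
    obtain u v where "u \<in> I" "u < x" "v \<in> I" "x < v"
      using x cInf_lessD[OF I(2), of x] less_cSupD[OF I(2), of x] by (auto simp: a_def b_def)
    with assms(1) show "x \<in> I" by (meson is_interval_1 less_imp_le)
  qed
  then have "emeasure lebesgue {a<..<b} \<le> emeasure lebesgue I"
    using I by (intro emeasure_mono) auto
  moreover have ab: "a < b"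
  proof (rule ccontr)
    assume "\<not> a < b"
    then have "I \<subseteq> {a}" using sub by auto
    then have "emeasure lebesgue I \<le> emeasure lebesgue {a}"
      by (intro emeasure_mono) auto
    then have "measure lebesgue I = 0"
      by (simp add: measure_def)
    with assms(3) show False by simp
  qed
  ultimately have len: "ennreal (b - a) \<le> emeasure lebesgue I" by simp
  obtain c where c: "c \<in> \<rat>" "(a + b) / 2 < c" "c < (a + b) / 2 + (b - a) / 4"
    using Rats_dense_in_real[of "(a + b) / 2" "(a + b) / 2 + (b - a) / 4"] ab by auto
  obtain r where r: "r \<in> \<rat>" "3 * (b - a) / 4 < r" "r < b - a"
    using Rats_dense_in_real[of "3 * (b - a) / 4" "b - a"] ab by auto
  show ?thesis
  proof
    show "(c, r) \<in> rational_balls" using c r ab by (auto simp: rational_balls_def)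
    have "{a..b} \<subseteq> ball c r"
      using c r by (auto simp: dist_real_def abs_less_iff field_simps)
    with sub show "I \<subseteq> ball c r" by blast
    show "ennreal r \<le> emeasure lebesgue I"
      using r by (intro order_trans[OF _ len] ennreal_leI) simp
  qed
qed

lemma directional_maximal_le_rational:
  assumes [measurable]: "G \<in> borel_measurable borel" and le: "\<And>x. F x \<le> G x"
  shows "directional_maximal k F x \<le> rational_directional_maximal k G x"
  unfolding directional_maximal_def
proof (rule SUP_least)
  fix I assume "I \<in> {I. is_interval I \<and> bounded I \<and> 0 < measure lebesgue I \<and> x $ k \<in> I}"
  then have I: "is_interval I" "bounded I" "0 < measure lebesgue I" and x: "x $ k \<in> I" by auto
  obtain c r where cr: "(c, r) \<in> rational_balls" "I \<subseteq> ball c r" "ennreal r \<le> emeasure lebesgue I"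
    using interval_in_rational_ball[OF I] .
  have "(\<integral>\<^sup>+y\<in>I. F (upd x k y) \<partial>lebesgue) \<le> (\<integral>\<^sup>+y\<in>ball c r. G (upd x k y) \<partial>lborel)"
    unfolding nn_integral_completion
    using cr(2) le by (intro nn_integral_mono mult_mono) (auto simp: indicator_def)
  then have "(\<integral>\<^sup>+y\<in>I. F (upd x k y) \<partial>lebesgue) / emeasure lebesgue I
      \<le> (\<integral>\<^sup>+y\<in>ball c r. G (upd x k y) \<partial>lborel) / ennreal r"
    using cr(3) by (auto simp: divide_ennreal_def intro!: mult_mono ennreal_inverse_antimono)
  also have "\<dots> = indicator (ball c r) (x $ k) * (\<dots>)"
    using cr(2) x by (auto simp: indicator_def)
  also have "\<dots> \<le> rational_directional_maximal k G x"
    unfolding rational_directional_maximal_def rational_maximal_def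
    by (rule SUP_upper2[OF cr(1)]) simp
  finally show "(\<integral>\<^sup>+y\<in>I. F (upd x k y) \<partial>lebesgue) / emeasure lebesgue I
      \<le> rational_directional_maximal k G x" .
qed

section \<open>Morrey estimates for one directional operator\<close>

definition centred_cube :: "real ^ 'n \<Rightarrow> real \<Rightarrow> (real ^ 'n) set" where
  "centred_cube z \<rho> = {x. \<forall>i. \<bar>x $ i - z $ i\<bar> \<le> \<rho>}"

lemma centred_cube_eq_cbox: "centred_cube z \<rho> = cbox (z - (\<chi> i. \<rho>)) (z + (\<chi> i. \<rho>))"
  by (auto simp: centred_cube_def mem_box_cart abs_le_iff algebra_simps)

lemma cubes_eq_centred: "cubes = {centred_cube z \<rho> |z \<rho>. 0 < \<rho>}"
proof (intro equalityI subsetI)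
  fix Q :: "(real ^ 'n) set" assume "Q \<in> cubes"
  then obtain a b l where Q: "Q = cbox a b" "0 < l" "\<And>i. b $ i = a $ i + l"
    by (auto simp: cubes_def)
  have "Q = centred_cube (\<chi> i. a $ i + l / 2) (l / 2)"
    unfolding centred_cube_eq_cbox Q(1)
    by (rule arg_cong2[of _ _ _ _ cbox]) (auto simp: vec_eq_iff Q(3))
  with Q(2) show "Q \<in> {centred_cube z \<rho> |z \<rho>. 0 < \<rho>}" by force
next
  fix Q :: "(real ^ 'n) set" assume "Q \<in> {centred_cube z \<rho> |z \<rho>. 0 < \<rho>}"
  then obtain z \<rho> where "Q = centred_cube z \<rho>" "0 < \<rho>" by auto
  then show "Q \<in> cubes"
    unfolding cubes_def centred_cube_eq_cbox by (intro CollectI exI[of _ "z - (\<chi> i. \<rho>)"] exI[of _ "z + (\<chi> i. \<rho>)"] conjI exI[of _ "2 * \<rho>"]) auto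
qed

lemma measure_centred_cube:
  assumes "0 < \<rho>"
  shows "measure lebesgue (centred_cube (z :: real ^ 'n) \<rho>) = (2 * \<rho>) ^ CARD('n)"
proof -
  have "cbox (z - (\<chi> i. \<rho>)) (z + (\<chi> i. \<rho>)) \<noteq> {}"
    using assms by (auto simp: interval_ne_empty_cart)
  then show ?thesis
    unfolding centred_cube_eq_cbox by (simp add: content_cbox_cart)
qed

lemma borel_centred_cube [measurable]: "centred_cube z \<rho> \<in> sets borel"
  by (simp add: centred_cube_eq_cbox)

text \<open>
  For the least \<open>j\<close> with \<open>x \<in> centred_cube z (2 ^ j * \<rho>)\<close>, the term with index \<open>j\<close> alone suffices: either
  \<open>j = 0\<close>, or \<open>x $ k\<close> is further than \<open>2\<^bsup>j-1\<^esup>\<rho>\<close> from \<open>z $ k\<close>.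
\<close>
lemma tail_weight_le_dyadic:
  fixes x z :: "real ^ 'n"
  assumes \<rho>: "0 < \<rho>" and strip: "\<And>i. i \<noteq> k \<Longrightarrow> \<bar>x $ i - z $ i\<bar> \<le> \<rho>"
  shows "ennreal (16 * \<rho> / (\<rho> + \<bar>x $ k - z $ k\<bar>))
           \<le> (\<Sum>j. ennreal (32 / 2 ^ j) * indicator (centred_cube z (2 ^ j * \<rho>)) x)"
proof -
  define d where "d = \<bar>x $ k - z $ k\<bar>"
  have d: "0 \<le> d" by (simp add: d_def)
  have "\<exists>j. d \<le> 2 ^ j * \<rho>"
  proof -
    obtain j where "d / \<rho> < 2 ^ j" using real_arch_pow[of 2 "d / \<rho>"] by auto
    with \<rho> show ?thesis by (intro exI[of _ j]) (simp add: field_simps)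
  qed
  then obtain j where j: "d \<le> 2 ^ j * \<rho>" and least: "\<And>i. i < j \<Longrightarrow> 2 ^ i * \<rho> < d"
    using exists_least_iff[of "\<lambda>j. d \<le> 2 ^ j * \<rho>"] by (auto simp: not_le)
  have "\<rho> \<le> 2 ^ j * \<rho>" using \<rho> by simp
  then have "x \<in> centred_cube z (2 ^ j * \<rho>)"
    unfolding centred_cube_def mem_Collect_eq
    using j strip by (metis d_def order_trans)
  moreover have "16 * \<rho> / (\<rho> + d) \<le> 32 / 2 ^ j"
  proof (cases j)
    case 0
    then show ?thesis using \<rho> d by (simp add: field_simps)
  next
    case (Suc i)
    then have "2 ^ i * \<rho> < d" using least by simp
    then show ?thesis using \<rho> d Suc by (simp add: field_simps)
  qed
  ultimately have "ennreal (16 * \<rho> / (\<rho> + d))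
      \<le> (\<Sum>j\<in>{j}. ennreal (32 / 2 ^ j) * indicator (centred_cube z (2 ^ j * \<rho>)) x)"
    by (simp add: ennreal_leI)
  also have "\<dots> \<le> (\<Sum>j. ennreal (32 / 2 ^ j) * indicator (centred_cube z (2 ^ j * \<rho>)) x)"
    by (rule sum_le_suminf) (auto intro: summableI)
  finally show ?thesis by (simp add: d_def)
qed

text \<open>
  The weighted inequality is applied on each line in direction \<open>k\<close> through \<open>Q\<close>. The lines fill an infinite
  strip \<open>S\<close>, and on it the weight is bounded by a dyadic sum over the dilates \<open>2\<^sup>jQ\<close>. Their volume grows like
  \<open>2\<^bsup>jn\<^esup>\<close>, so the hypothesis bounds the \<open>j\<close>-th term by a multiple of \<open>2\<^bsup>-j\<^esup>2\<^bsup>jn\<theta>\<^esup>\<close>, and the sum is a convergent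
  geometric series because \<open>n\<theta> < 1\<close>.
\<close>
lemma rational_directional_maximal_morrey:
  fixes G :: "real ^ 'n \<Rightarrow> ennreal"
  assumes [measurable]: "G \<in> borel_measurable borel"
    and s: "1 < s" and \<theta>: "real CARD('n) * \<theta> < 1"
    and G: "\<And>Q. Q \<in> cubes \<Longrightarrow> (\<integral>\<^sup>+x\<in>Q. ennpowr (G x) s \<partial>lborel) \<le> ennreal (L * measure lebesgue Q powr \<theta>)"
    and L: "0 \<le> L" and Q: "Q \<in> cubes"
  shows "(\<integral>\<^sup>+x\<in>Q. ennpowr (rational_directional_maximal k G x) s \<partial>lborel)
           \<le> ennreal (4 powr s * s / (s - 1) * (32 / (1 - 2 powr (real CARD('n) * \<theta> - 1))) * L
                * measure lebesgue Q powr \<theta>)"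
proof -
  let ?n = "real CARD('n)"
  let ?T = "rational_directional_maximal k G"
  define A where "A = 4 powr s * s / (s - 1)"
  have A: "0 \<le> A" using s by (simp add: A_def)
  obtain z \<rho> where Qz: "Q = centred_cube z \<rho>" and \<rho>: "0 < \<rho>"
    using Q by (auto simp: cubes_eq_centred)
  define S where "S = {x. \<forall>i. i \<noteq> k \<longrightarrow> \<bar>x $ i - z $ i\<bar> \<le> \<rho>}"
  define w where "w = (\<lambda>y. ennreal (16 * \<rho> / (\<rho> + \<bar>y - z $ k\<bar>)))"
  have [measurable]: "w \<in> borel_measurable borel" unfolding w_def by measurable
  have [measurable]: "S \<in> sets borel" unfolding S_def by measurable
  have [measurable]: "Q \<in> sets borel" unfolding Qz by measurable
  have [measurable]: "(\<lambda>x::real ^ 'n. w (x $ k)) \<in> borel_measurable borel" by measurable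
  have lines: "(\<integral>\<^sup>+x. ennpowr (?T x) s * indicator Q x \<partial>lborel)
      \<le> (\<integral>\<^sup>+x. ennreal A * (ennpowr (G x) s * w (x $ k)) * indicator S x \<partial>lborel)"
  proof (rule nn_integral_le_by_lines[where k = k])
    fix x :: "real ^ 'n"
    let ?g = "\<lambda>y. G (upd x k y)"
    have [measurable]: "?g \<in> borel_measurable borel"
    proof (rule measurable_compose[OF _ assms(1)])
      have "(\<lambda>y. case (x, y) of (x, y) \<Rightarrow> upd x k y) \<in> borel_measurable borel"
        by (rule measurable_compose[OF _ measurable_upd]) simp
      then show "upd x k \<in> borel_measurable borel" by simp
    qed
    have [measurable]: "cball (z $ k) \<rho> \<in> sets borel" by simp
    have indQ: "indicator Q (upd x k y) = indicator S x * (indicator (cball (z $ k) \<rho>) y :: ennreal)" for y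
      by (auto simp: indicator_def Qz centred_cube_def S_def dist_real_def abs_minus_commute split: if_splits)
    have indS: "indicator S (upd x k y) = (indicator S x :: ennreal)" for y
      by (simp add: indicator_def S_def)
    have T: "?T (upd x k y) = rational_maximal ?g y" for y
    proof -
      have "upd (upd x k y) k y' = upd x k y'" for y' by (simp add: vec_eq_iff)
      then show ?thesis by (simp add: rational_directional_maximal_def)
    qed
    have "(\<integral>\<^sup>+y. ennpowr (?T (upd x k y)) s * indicator Q (upd x k y) \<partial>lborel)
        = indicator S x * (\<integral>\<^sup>+y\<in>cball (z $ k) \<rho>. ennpowr (rational_maximal ?g y) s \<partial>lborel)"
      unfolding indQ T by (subst nn_integral_cmult[symmetric], measurable) (simp add: ac_simps)
    also have "\<dots> \<le> indicator S x * (ennreal A * (\<integral>\<^sup>+y. ennpowr (?g y) s * w y \<partial>lborel))"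
      unfolding A_def w_def
      by (intro mult_left_mono rational_maximal_strong_type interval_weight_dominates s \<rho>) auto
    also have "\<dots> = (\<integral>\<^sup>+y. ennreal A * (ennpowr (?g y) s * w (upd x k y $ k)) * indicator S (upd x k y) \<partial>lborel)"
      unfolding indS
      by (subst nn_integral_multc, measurable, subst nn_integral_cmult, measurable) (simp add: ac_simps)
    finally show "(\<integral>\<^sup>+y. ennpowr (?T (upd x k y)) s * indicator Q (upd x k y) \<partial>lborel)
        \<le> (\<integral>\<^sup>+y. ennreal A * (ennpowr (G (upd x k y)) s * w (upd x k y $ k)) * indicator S (upd x k y) \<partial>lborel)" .
  qed measurable
  define q where "q = 2 powr (?n * \<theta> - 1)"
  have q: "0 < q" "q < 1" using \<theta> powr_less_mono[of "?n * \<theta> - 1" 0 2] by (auto simp: q_def)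
  define V where "V = measure lebesgue Q powr \<theta>"
  have V: "0 \<le> V" by (simp add: V_def)
  have "(\<integral>\<^sup>+x. ennreal A * (ennpowr (G x) s * w (x $ k)) * indicator S x \<partial>lborel)
      \<le> (\<integral>\<^sup>+x. (\<Sum>j. ennreal (A * (32 / 2 ^ j)) *
             (ennpowr (G x) s * indicator (centred_cube z (2 ^ j * \<rho>)) x)) \<partial>lborel)"
  proof (rule nn_integral_mono)
    fix x
    let ?\<Sigma> = "\<Sum>j. ennreal (32 / 2 ^ j) * indicator (centred_cube z (2 ^ j * \<rho>)) x"
    have "w (x $ k) * indicator S x \<le> ?\<Sigma>"
      using tail_weight_le_dyadic[OF \<rho>, of k x z]
      by (cases "x \<in> S") (auto simp: w_def S_def)
    then have "ennreal A * ennpowr (G x) s * (w (x $ k) * indicator S x)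
        \<le> ennreal A * ennpowr (G x) s * ?\<Sigma>"
      by (rule mult_left_mono) simp
    also have "\<dots> = (\<Sum>j. ennreal (A * (32 / 2 ^ j)) *
             (ennpowr (G x) s * indicator (centred_cube z (2 ^ j * \<rho>)) x))"
    proof -
      have "ennreal A * ennpowr (G x) s * (ennreal (32 / 2 ^ j) * indicator (centred_cube z (2 ^ j * \<rho>)) x)
          = ennreal (A * (32 / 2 ^ j)) * (ennpowr (G x) s * indicator (centred_cube z (2 ^ j * \<rho>)) x)" for j
        using A by (simp only: ennreal_mult' ac_simps)
      then show ?thesis by (simp only: ennreal_suminf_cmult[symmetric])
    qed
    finally show "ennreal A * (ennpowr (G x) s * w (x $ k)) * indicator S x \<le> \<dots>"
      by (simp add: ac_simps)
  qed
  also have "\<dots> = (\<Sum>j. ennreal (A * (32 / 2 ^ j)) *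
             (\<integral>\<^sup>+x\<in>centred_cube z (2 ^ j * \<rho>). ennpowr (G x) s \<partial>lborel))"
    by (subst nn_integral_suminf) (auto simp: nn_integral_cmult)
  also have "\<dots> \<le> (\<Sum>j. ennreal (A * 32 * L * V * q ^ j))"
  proof (intro suminf_le summableI)
    fix j
    have pos: "0 < 2 ^ j * \<rho>" using \<rho> by simp
    have "measure lebesgue (centred_cube z (2 ^ j * \<rho>)) powr \<theta> = V * (2 ^ j) powr (?n * \<theta>)"
      using \<rho> unfolding measure_centred_cube[OF pos] V_def Qz measure_centred_cube[OF \<rho>]
      by (simp add: powr_realpow[symmetric] powr_powr powr_mult mult_ac)
    also have "(2 ^ j) powr (?n * \<theta>) = q ^ j * 2 ^ j"
      by (simp add: q_def powr_realpow[symmetric] powr_powr powr_add[symmetric] algebra_simps)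
    finally have vol: "L * measure lebesgue (centred_cube z (2 ^ j * \<rho>)) powr \<theta> = L * V * q ^ j * 2 ^ j"
      by simp
    have "ennreal (A * (32 / 2 ^ j)) * (\<integral>\<^sup>+x\<in>centred_cube z (2 ^ j * \<rho>). ennpowr (G x) s \<partial>lborel)
        \<le> ennreal (A * (32 / 2 ^ j)) * ennreal (L * V * q ^ j * 2 ^ j)"
      unfolding vol[symmetric] using pos by (intro mult_left_mono G) (auto simp: cubes_eq_centred)
    also have "\<dots> = ennreal (A * 32 * L * V * q ^ j)"
      using A L V q by (simp add: ennreal_mult[symmetric])
    finally show "ennreal (A * (32 / 2 ^ j)) * (\<integral>\<^sup>+x\<in>centred_cube z (2 ^ j * \<rho>). ennpowr (G x) s \<partial>lborel)
        \<le> ennreal (A * 32 * L * V * q ^ j)" .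
  qed
  also have "\<dots> = ennreal (A * 32 * L * V * (1 / (1 - q)))"
    using A L V q by (intro suminf_ennreal_eq sums_mult geometric_sums) auto
  finally show ?thesis
    using lines by (simp add: A_def V_def q_def mult_ac)
qed

section \<open>Borel majorants, Morrey norms and the iteration\<close>

text \<open>
  Lines are null sets in dimension at least \<open>2\<close>, so a Lebesgue measurable function may be non-measurable
  on some of them. A majorant that is Borel everywhere has Borel restrictions to all lines.
\<close>
lemma borel_majorant:
  fixes F :: "'a::euclidean_space \<Rightarrow> ennreal"
  assumes "F \<in> borel_measurable lebesgue"
  shows "\<exists>G\<in>borel_measurable borel. (\<forall>x. F x \<le> G x) \<and> (AE x in lborel. G x = F x)"
proof -
  obtain g where [measurable]: "g \<in> borel_measurable borel" and ae: "AE x in lborel. F x = g x"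
    using completion_ex_borel_measurable[OF assms] by auto
  obtain N where N: "{x. F x \<noteq> g x} \<subseteq> N" "N \<in> null_sets lborel"
    using ae by (auto elim!: AE_E simp: null_sets_def)
  have [measurable]: "N \<in> sets borel" using N(2) by auto
  have eq: "F x = g x" if "x \<notin> N" for x using that N(1) by blast
  show ?thesis
  proof (intro bexI[of _ "\<lambda>x. if x \<in> N then \<infinity> else g x"] conjI allI)
    show "(\<lambda>x. if x \<in> N then \<infinity> else g x) \<in> borel_measurable borel" by measurable
    show "F x \<le> (if x \<in> N then \<infinity> else g x)" for x by (simp add: eq)
    show "AE x in lborel. (if x \<in> N then \<infinity> else g x) = F x"
      using AE_not_in[OF N(2)] ae by eventually_elim simp
  qed
qed

text \<open>
  Raising the defining inequality on each cube to the power \<open>q\<close> removes the outer root. The resulting bound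
  is linear in the integral, and it is in this form that the maximal operators propagate it.
\<close>
lemma morrey_norm_le_iff:
  fixes F :: "real ^ 'n \<Rightarrow> ennreal"
  assumes q: "0 < q" and \<nu>: "0 \<le> \<nu>"
  shows "morrey_norm p q F \<le> ennreal \<nu> \<longleftrightarrow>
    (\<forall>Q\<in>cubes. (\<integral>\<^sup>+x\<in>Q. ennpowr (F x) q \<partial>lborel)
                  \<le> ennreal (\<nu> powr q * measure lebesgue Q powr (1 - q / p)))"
proof -
  have "ennreal (V powr (1 / p - 1 / q)) * ennpowr X (1 / q) \<le> ennreal \<nu> \<longleftrightarrow>
        X \<le> ennreal (\<nu> powr q * V powr (1 - q / p))" if V: "0 < V" for V :: real and X
  proof (cases X)
    case (real x)
    let ?a = "V powr (1 / p - 1 / q) * x powr (1 / q)"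
    have "ennreal (V powr (1 / p - 1 / q)) * ennpowr X (1 / q) \<le> ennreal \<nu> \<longleftrightarrow> ?a \<le> \<nu>"
      using real \<nu> by (simp add: ennpowr_ennreal ennreal_mult[symmetric] ennreal_le_iff)
    also have "\<dots> \<longleftrightarrow> ?a powr q \<le> \<nu> powr q"
      using q \<nu> powr_mono2[of q ?a \<nu>] powr_less_mono2[of q \<nu> ?a]
      by (cases "?a \<le> \<nu>") (auto simp: not_le)
    also have "?a powr q = x * V powr (q / p - 1)"
    proof -
      have "(1 / p - 1 / q) * q = q / p - 1" using q by (simp add: left_diff_distrib)
      then show ?thesis using real q by (simp add: powr_mult powr_powr)
    qed
    also have "\<dots> \<le> \<nu> powr q \<longleftrightarrow> x * V powr (q / p - 1) * V powr (1 - q / p) \<le> \<nu> powr q * V powr (1 - q / p)"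
      using V by simp
    also have "x * V powr (q / p - 1) * V powr (1 - q / p) = x"
      using V by (simp add: mult.assoc powr_add[symmetric])
    also have "x \<le> \<nu> powr q * V powr (1 - q / p) \<longleftrightarrow> X \<le> ennreal (\<nu> powr q * V powr (1 - q / p))"
      using real by (simp add: ennreal_le_iff)
    finally show ?thesis .
  next
    case top
    with V show ?thesis by (simp add: ennreal_mult_top top_unique)
  qed
  moreover have "0 < measure lebesgue Q" if "Q \<in> cubes" for Q :: "(real ^ 'n) set"
  proof -
    obtain z \<rho> where "Q = centred_cube z \<rho>" "0 < \<rho>"
      using \<open>Q \<in> cubes\<close> by (auto simp: cubes_eq_centred)
    then show ?thesis by (simp only: measure_centred_cube) simp
  qed
  ultimately show ?thesis
    unfolding morrey_norm_def SUP_le_iff nn_integral_completion by blast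
qed

text \<open>
  The functions \<open>F\<close> that arise along the iteration need not be measurable. So the induction carries a Borel
  majorant \<open>G\<close>, which the rational operator turns into a Borel majorant of the next function.
\<close>
lemma fold_directional_maximal_morrey:
  fixes F G :: "real ^ 'n \<Rightarrow> ennreal"
  assumes s: "1 < s" and \<theta>: "real CARD('n) * \<theta> < 1"
    and C: "C = 4 powr s * s / (s - 1) * (32 / (1 - 2 powr (real CARD('n) * \<theta> - 1)))"
    and G: "G \<in> borel_measurable borel" "\<And>x. F x \<le> G x" and L: "0 \<le> L"
    and bound: "\<And>Q. Q \<in> cubes \<Longrightarrow>
      (\<integral>\<^sup>+x\<in>Q. ennpowr (G x) s \<partial>lborel) \<le> ennreal (L * measure lebesgue Q powr \<theta>)"
    and Q: "Q \<in> cubes"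
  shows "(\<integral>\<^sup>+x\<in>Q. ennpowr (fold directional_maximal ks F x) s \<partial>lborel)
           \<le> ennreal (C ^ length ks * L * measure lebesgue Q powr \<theta>)"
  using G L bound
proof (induction ks arbitrary: F G L)
  case Nil
  have "(\<integral>\<^sup>+x\<in>Q. ennpowr (F x) s \<partial>lborel) \<le> (\<integral>\<^sup>+x\<in>Q. ennpowr (G x) s \<partial>lborel)"
    using s Nil(2) by (intro nn_integral_mono mult_right_mono ennpowr_mono) auto
  with Nil(4)[OF Q] show ?case by simp
next
  case (Cons k ks)
  have "2 powr (real CARD('n) * \<theta> - 1) < 1"
    using \<theta> powr_less_mono[of "real CARD('n) * \<theta> - 1" 0 2] by simp
  then have C0: "0 \<le> C" using s by (simp add: C)
  have "(\<integral>\<^sup>+x\<in>Q. ennpowr (fold directional_maximal ks (directional_maximal k F) x) s \<partial>lborel)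
           \<le> ennreal (C ^ length ks * (C * L) * measure lebesgue Q powr \<theta>)"
  proof (rule Cons.IH)
    show "rational_directional_maximal k G \<in> borel_measurable borel"
      using Cons.prems(1) by measurable
    show "directional_maximal k F x \<le> rational_directional_maximal k G x" for x
      using Cons.prems(1,2) by (rule directional_maximal_le_rational)
    show "(\<integral>\<^sup>+x\<in>Q. ennpowr (rational_directional_maximal k G x) s \<partial>lborel)
        \<le> ennreal (C * L * measure lebesgue Q powr \<theta>)" if "Q \<in> cubes" for Q
      unfolding C by (rule rational_directional_maximal_morrey[OF Cons.prems(1) s \<theta> Cons.prems(4,3) that])
    show "0 \<le> C * L" using C0 Cons.prems(3) by simp
  qed
  then show ?case by (simp add: mult_ac)
qed

theorem corollary1p5:
  fixes p q t :: real
  assumes "0 < p"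
    and "(real CARD('n::{finite,linorder}) - 1) / real CARD('n) * p < q"
    and "q \<le> p"
    and "0 < t" and "t < q"
  shows "\<exists>C>0. \<forall>f \<in> (morrey_space p q :: (real ^ 'n::{finite,linorder} \<Rightarrow> complex) set).
           morrey_norm p q (iterated_maximal t f)
             \<le> ennreal C * morrey_norm p q (\<lambda>x. ennreal (norm (f x)))"
proof -
  let ?n = "real CARD('n)"
  let ?ks = "sorted_list_of_set (UNIV :: 'n set)"
  define s where "s = q / t"
  define \<theta> where "\<theta> = 1 - q / p"
  define A where "A = 4 powr s * s / (s - 1) * (32 / (1 - 2 powr (?n * \<theta> - 1)))"
  define C where "C = (A ^ length ?ks) powr (1 / q)"
  have q: "0 < q" using assms by simp
  have s: "1 < s" using assms by (simp add: s_def)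
  have n: "0 < ?n" by simp
  have \<theta>: "?n * \<theta> < 1"
  proof -
    have "(?n - 1) * p < q * ?n" using assms(2) n by (simp add: field_simps)
    then show ?thesis using assms(1) n by (simp add: \<theta>_def field_simps)
  qed
  have "2 powr (?n * \<theta> - 1) < 1"
    using \<theta> powr_less_mono[of "?n * \<theta> - 1" 0 2] by simp
  then have A: "0 < A" using s by (simp add: A_def)
  then have C: "0 < C" by (simp add: C_def)
  have Cq: "C powr q = A ^ length ?ks" using A q by (simp add: C_def powr_powr)
  have "morrey_norm p q (iterated_maximal t f) \<le> ennreal C * morrey_norm p q (\<lambda>x. ennreal (norm (f x)))"
    if f: "f \<in> morrey_space p q" for f :: "real ^ 'n::{finite,linorder} \<Rightarrow> complex"
  proof -
    let ?F = "\<lambda>x. ennreal (norm (f x) powr t)"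
    have [measurable]: "f \<in> borel_measurable lebesgue"
      and "morrey_norm p q (\<lambda>x. ennreal (norm (f x))) < \<infinity>"
      using f by (auto simp: morrey_space_def)
    then obtain \<nu> where \<nu>: "morrey_norm p q (\<lambda>x. ennreal (norm (f x))) = ennreal \<nu>" "0 \<le> \<nu>"
      by (auto simp: less_top_ennreal)
    have F: "?F \<in> borel_measurable lebesgue" by measurable
    obtain G where G: "G \<in> borel_measurable borel" "\<And>x. ?F x \<le> G x" "AE x in lborel. G x = ?F x"
      using borel_majorant[OF F] by blast
    have Fq: "ennpowr (?F x) s = ennpowr (ennreal (norm (f x))) q" for x
      using assms by (simp add: ennpowr_ennreal powr_powr s_def)
    have bound: "(\<integral>\<^sup>+x\<in>Q. ennpowr (G x) s \<partial>lborel) \<le> ennreal (\<nu> powr q * measure lebesgue Q powr \<theta>)"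
      if "Q \<in> cubes" for Q
    proof -
      have "(\<integral>\<^sup>+x\<in>Q. ennpowr (G x) s \<partial>lborel) = (\<integral>\<^sup>+x\<in>Q. ennpowr (ennreal (norm (f x))) q \<partial>lborel)"
        using G(3) by (intro nn_integral_cong_AE) (auto simp: Fq)
      also have "\<dots> \<le> ennreal (\<nu> powr q * measure lebesgue Q powr \<theta>)"
        using morrey_norm_le_iff[OF q \<nu>(2), of p "\<lambda>x. ennreal (norm (f x))"] \<nu>(1) that
        by (auto simp: \<theta>_def)
      finally show ?thesis .
    qed
    have "morrey_norm p q (iterated_maximal t f) \<le> ennreal (C * \<nu>)"
    proof (subst morrey_norm_le_iff[OF q], safe)
      show "0 \<le> C * \<nu>" using C \<nu> by simp
      fix Q :: "(real ^ 'n::{finite,linorder}) set" assume Q: "Q \<in> cubes"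
      have "(\<integral>\<^sup>+x\<in>Q. ennpowr (fold directional_maximal ?ks ?F x) s \<partial>lborel)
          \<le> ennreal (A ^ length ?ks * \<nu> powr q * measure lebesgue Q powr \<theta>)"
        by (intro fold_directional_maximal_morrey[OF s \<theta> A_def G(1,2) _ bound Q]) simp
      then show "(\<integral>\<^sup>+x\<in>Q. ennpowr (iterated_maximal t f x) q \<partial>lborel)
          \<le> ennreal ((C * \<nu>) powr q * measure lebesgue Q powr (1 - q / p))"
        using C \<nu> by (simp add: iterated_maximal_def ennpowr_ennpowr s_def powr_mult Cq \<theta>_def)
    qed
    also have "\<dots> = ennreal C * ennreal \<nu>" using C \<nu> by (simp add: ennreal_mult)
    finally show ?thesis by (simp add: \<nu>)
  qed
  with C show ?thesis by blast
qed

end
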